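(* Let $F$ be a piecewise interval map (PIM) on $[0,1)$ (type A, type B or mixed type). If $F$ satisfies topological transitivity (TT), then $F$-representations are valid.
   Context: Let $\lambda$ be Lebesgue measure on $[0,1)$. An interval partition is a finite or countable indexed collection $\xi=\{\Delta(d)\subseteq[0,1):d\in\mathcal D\}$ of disjoint intervals, $2\le \#(\xi)\le\infty$, with $\lambda(D)=1$ where $D=\bigcup_{d\in\mathcal D}\Delta(d)$. Each $\Delta(d)$ has endpoints $a_d<b_d$ and may be open, closed, or half-open on either side. A piecewise interval map (PIM) $F$ on $[0,1)$ is an interval partition $\xi$ together with a map $F:D\to[0,1)$ such that: (1) each $F|_{\Delta(d)}$ is continuous and strictly monotonic; (2) $\lambda([0,1)\setminus B)=0$, where $B=\{x: F^n x\in D \text{ for all } n\ge 0\}$; (3) for all $n\ge1$ and $d_1,\dots,d_n\in\mathcal D$, the set $\Delta(d_1d_2\dots d_n)=\Delta(d_1)\cap F^{-1}\Delta(d_2)\cap\dots\cap F^{-n+1}\Delta(d_n)$ is either empty or an interval of positive length. $F$ is not required to be surjective. $F$ is type A if every $F|_{\Delta(d)}$ is increasing, type B if every $F|_{\Delta(d)}$ is decreasing, and mixed type otherwise. TT: there is $x\in B$ such that the forward orbit $O^+(x)=\{F^n x:n\ge 0\}$ is dense in $[0,1)$. For $x\in B$ the $F$-representation of $x$ is the sequence $\mathbf r(x)=.d_1d_2d_3\dots\in\mathcal D^{\mathbb N}$, where $d_n$ is the unique digit with $F^{n-1}x\in\Delta(d_n)$. $F$-representations are valid if the map $\mathbf r$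 is injective for $\lambda$-a.e. $x\in B$, i.e. there is a $\lambda$-null set $N$ such that $\mathbf r$ is injective on $B\setminus N$. *)

theory Defs
  imports "HOL-Analysis.Analysis"
begin

definition proper_interval :: "real set \<Rightarrow> bool" where
  "proper_interval I \<longleftrightarrow>
     (\<exists>a b. a < b \<and> (I = {a..b} \<or> I = {a..<b} \<or> I = {a<..b} \<or> I = {a<..<b}))"

abbreviation unit_lebesgue :: "real measure" where
  "unit_lebesgue \<equiv> lebesgue_on {0..<1}"

abbreviation partition_domain :: "'d set \<Rightarrow> ('d \<Rightarrow> real set) \<Rightarrow> real set" where
  "partition_domain \<D> \<Delta> \<equiv> (\<Union>d\<in>\<D>. \<Delta> d)"

definition interval_partition :: "'d set \<Rightarrow> ('d \<Rightarrow> real set) \<Rightarrow> bool" where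
  "interval_partition \<D> \<Delta> \<longleftrightarrow>
     countable \<D> \<and> (infinite \<D> \<or> 2 \<le> card \<D>) \<and>
     (\<forall>d\<in>\<D>. proper_interval (\<Delta> d) \<and> \<Delta> d \<subseteq> {0..<1}) \<and>
     disjoint_family_on \<Delta> \<D> \<and>
     emeasure unit_lebesgue (partition_domain \<D> \<Delta>) = 1"

(* A map defined only on the partition domain is represented by a total function whose
   values elsewhere are irrelevant: in both definitions below, a condition on the (n+1)-st
   iterate is only imposed together with the membership of the earlier iterates
   in the domain. *)

definition iterable_points ::
  "'d set \<Rightarrow> ('d \<Rightarrow> real set) \<Rightarrow> (real \<Rightarrow> real) \<Rightarrow> real set" where
  "iterable_points \<D> \<Delta> F = {x. \<forall>n. (F ^^ n) x \<in> partition_domain \<D> \<Delta>}"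

definition cylinder :: "('d \<Rightarrow> real set) \<Rightarrow> (real \<Rightarrow> real) \<Rightarrow> 'd list \<Rightarrow> real set" where
  "cylinder \<Delta> F ds = (\<Inter>i<length ds. (F ^^ i) -` \<Delta> (ds ! i))"

definition piecewise_interval_map ::
  "'d set \<Rightarrow> ('d \<Rightarrow> real set) \<Rightarrow> (real \<Rightarrow> real) \<Rightarrow> bool" where
  "piecewise_interval_map \<D> \<Delta> F \<longleftrightarrow>
     interval_partition \<D> \<Delta> \<and>
     F \<in> partition_domain \<D> \<Delta> \<rightarrow> {0..<1} \<and>
     (\<forall>d\<in>\<D>. continuous_on (\<Delta> d) F \<and>
        (strict_mono_on (\<Delta> d) F \<or> strict_antimono_on (\<Delta> d) F)) \<and>
     {0..<1} - iterable_points \<D> \<Delta> F \<in> null_sets unit_lebesgue \<and>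
     (\<forall>ds. ds \<noteq> [] \<and> set ds \<subseteq> \<D> \<longrightarrow>
        cylinder \<Delta> F ds = {} \<or> proper_interval (cylinder \<Delta> F ds))"

definition forward_orbit :: "(real \<Rightarrow> real) \<Rightarrow> real \<Rightarrow> real set" where
  "forward_orbit F x = range (\<lambda>n. (F ^^ n) x)"

definition topologically_transitive ::
  "'d set \<Rightarrow> ('d \<Rightarrow> real set) \<Rightarrow> (real \<Rightarrow> real) \<Rightarrow> bool" where
  "topologically_transitive \<D> \<Delta> F \<longleftrightarrow>
     (\<exists>x\<in>iterable_points \<D> \<Delta> F. {0..<1} \<subseteq> closure (forward_orbit F x))"

(* Digits are numbered from 0, so entry n is the digit of the n-th iterate. *)
definition representation ::
  "'d set \<Rightarrow> ('d \<Rightarrow> real set) \<Rightarrow> (real \<Rightarrow> real) \<Rightarrow> real \<Rightarrow> nat \<Rightarrow> 'd" where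
  "representation \<D> \<Delta> F x n = (THE d. d \<in> \<D> \<and> (F ^^ n) x \<in> \<Delta> d)"

definition valid_representations ::
  "'d set \<Rightarrow> ('d \<Rightarrow> real set) \<Rightarrow> (real \<Rightarrow> real) \<Rightarrow> bool" where
  "valid_representations \<D> \<Delta> F \<longleftrightarrow>
     (\<exists>N\<in>null_sets unit_lebesgue.
        inj_on (representation \<D> \<Delta> F) (iterable_points \<D> \<Delta> F - N))"

end

theory Submission
  imports Defs
begin

text \<open>
  If two points of \<open>B\<close> have the same representation, then so do all points between them, because
  cylinders are intervals. A dense orbit visits this open interval infinitely often, hence it
  contains a point whose representation is periodic, say with period \<open>m\<close>. On each set of points with
  a common representation, \<open>F ^^ m\<close> is monotone or antimonotone, and so \<open>F ^^ (2 * m)\<close> is a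
  monotone self-map on each such set met by the tail of the orbit. The tail therefore splits into
  \<open>2 * m\<close> monotone, convergent sequences, and the closure of the orbit is countable.
\<close>

section \<open>Convergent sequences, monotone orbits and dense sequences\<close>

lemma closure_range_convergent_subset:
  fixes X :: "nat \<Rightarrow> 'a::heine_borel"
  assumes "X \<longlonglongrightarrow> L"
  shows "closure (range X) \<subseteq> insert L (range X)"
  by (rule closure_minimal) (use compact_sequence_with_limit[OF assms] compact_imp_closed in auto)

text \<open>Closing up each convergent sequence adds only its limit, and a finite union of closed
  sets is closed. So an orbit that splits in this way cannot be dense in an interval.\<close>

lemma countable_closure_finite_Un_convergent:
  fixes X :: "'i \<Rightarrow> nat \<Rightarrow> 'a::heine_borel"
  assumes "finite A" "finite I" "\<And>i. i \<in> I \<Longrightarrow> convergent (X i)"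
    and "S \<subseteq> A \<union> (\<Union>i\<in>I. range (X i))"
  shows "countable (closure S)"
proof -
  have "countable (closure (range (X i)))" if "i \<in> I" for i
  proof -
    obtain L where "X i \<longlonglongrightarrow> L" using assms(3)[OF \<open>i \<in> I\<close>] convergent_def by blast
    then have "closure (range (X i)) \<subseteq> insert L (range (X i))"
      by (rule closure_range_convergent_subset)
    moreover have "countable (insert L (range (X i)))"
      by (intro countable_insert countable_image countableI_type)
    ultimately show ?thesis by (rule countable_subset)
  qed
  then have "countable (A \<union> (\<Union>i\<in>I. closure (range (X i))))"
    using assms(1,2) by (intro countable_Un countable_UN) (auto simp: countable_finite)
  moreover have "closure S \<subseteq> A \<union> (\<Union>i\<in>I. closure (range (X i)))"
  proof (rule closure_minimal)
    show "S \<subseteq> A \<union> (\<Union>i\<in>I. closure (range (X i)))"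
      by (rule subset_trans[OF assms(4)]) (intro Un_mono UN_mono closure_subset subset_refl)
    show "closed (A \<union> (\<Union>i\<in>I. closure (range (X i))))"
      using assms(1,2) by (intro closed_Un closed_UN finite_imp_closed) auto
  qed
  ultimately show ?thesis by (rule countable_subset[rotated])
qed

text \<open>The order between \<open>q\<close> and \<open>g q\<close> is preserved by each further
  application of \<open>g\<close>, so it propagates along the orbit.\<close>

lemma monoseq_funpow_mono_on:
  fixes g :: "'a::linorder \<Rightarrow> 'a"
  assumes "mono_on E g" "g ` E \<subseteq> E" "q \<in> E"
  shows "monoseq (\<lambda>k. (g ^^ k) q)"
proof -
  have E: "(g ^^ k) q \<in> E" for k
    using assms by (induction k) auto
  show ?thesis
  proof (cases "q \<le> g q")
    case True
    have "(g ^^ k) q \<le> (g ^^ Suc k) q" for k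
    proof (induction k)
      case (Suc k)
      then show ?case using mono_onD[OF assms(1) E E, of k "Suc k"] by simp
    qed (use True in simp)
    then show ?thesis by (simp add: monoseq_Suc)
  next
    case False
    have "(g ^^ Suc k) q \<le> (g ^^ k) q" for k
    proof (induction k)
      case (Suc k)
      then show ?case using mono_onD[OF assms(1) E E, of "Suc k" k] by simp
    qed (use False in simp)
    then show ?thesis by (simp add: monoseq_Suc)
  qed
qed

lemma convex_proper_interval: "proper_interval I \<Longrightarrow> convex I"
  by (auto simp: proper_interval_def)

text \<open>Nonempty open sets in a perfect T1 space are infinite. If there were only finitely many
  visits, deleting the visited points would leave a nonempty open part of \<open>U\<close> missed by
  the sequence.\<close>

lemma infinite_dense_seq_hits:
  fixes X :: "nat \<Rightarrow> 'a::{t1_space,perfect_space}"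
  assumes "open U" "U \<noteq> {}" "U \<subseteq> closure (range X)"
  shows "infinite {n. X n \<in> U}"
proof
  assume fin: "finite {n. X n \<in> U}"
  define V where "V = U - X ` {n. X n \<in> U}"
  have "open V"
    unfolding V_def using assms(1) fin by (intro open_Diff finite_imp_closed) auto
  moreover have "infinite U"
  proof
    assume "finite U"
    from assms(2) obtain x where "x \<in> U" by blast
    then have "{x} = U - (U - {x})" by blast
    also have "open \<dots>"
      using assms(1) \<open>finite U\<close> by (intro open_Diff finite_imp_closed) auto
    finally show False using not_open_singleton by blast
  qed
  then have "V \<noteq> {}"
    unfolding V_def using fin by (metis Diff_eq_empty_iff finite_imageI finite_subset)
  moreover have "V \<inter> range X = {}" unfolding V_def by auto
  ultimately show False
    using assms(3) open_Int_closure_eq_empty[of V "range X"] unfolding V_def by blast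
qed

section \<open>Representations, the shift, and fibres as intervals\<close>

locale piecewise_interval =
  fixes \<D> :: "'d set" and \<Delta> :: "'d \<Rightarrow> real set" and F :: "real \<Rightarrow> real"
  assumes pim: "piecewise_interval_map \<D> \<Delta> F"
begin

abbreviation "B \<equiv> iterable_points \<D> \<Delta> F"
abbreviation "R \<equiv> representation \<D> \<Delta> F"

definition fibre :: "(nat \<Rightarrow> 'd) \<Rightarrow> real set" where
  "fibre r = {x \<in> B. R x = r}"

lemma digit_unique: "d \<in> \<D> \<Longrightarrow> e \<in> \<D> \<Longrightarrow> x \<in> \<Delta> d \<Longrightarrow> x \<in> \<Delta> e \<Longrightarrow> d = e"
  using pim unfolding piecewise_interval_map_def interval_partition_def disjoint_family_on_def
  by blast

lemma representation_eqI:
  assumes "d \<in> \<D>" "(F ^^ n) x \<in> \<Delta> d"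
  shows "R x n = d"
  unfolding representation_def using assms digit_unique by blast

lemma representation_digit:
  assumes "x \<in> B"
  shows "R x n \<in> \<D>" "(F ^^ n) x \<in> \<Delta> (R x n)"
proof -
  obtain d where "d \<in> \<D>" "(F ^^ n) x \<in> \<Delta> d"
    using assms unfolding iterable_points_def by blast
  then show "R x n \<in> \<D>" "(F ^^ n) x \<in> \<Delta> (R x n)"
    using representation_eqI by auto
qed

lemma fibreI: "range r \<subseteq> \<D> \<Longrightarrow> (\<And>n. (F ^^ n) x \<in> \<Delta> (r n)) \<Longrightarrow> x \<in> fibre r"
  unfolding fibre_def iterable_points_def by (auto intro!: representation_eqI)

lemma funpow_funpow: "(F ^^ n) ((F ^^ k) x) = (F ^^ (n + k)) x"
  by (simp add: funpow_add)

lemma representation_funpow: "R ((F ^^ k) x) n = R x (n + k)"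
  by (simp add: representation_def funpow_funpow)

lemma funpow_iterable: "x \<in> B \<Longrightarrow> (F ^^ k) x \<in> B"
  unfolding iterable_points_def by (simp add: funpow_funpow)

lemma funpow_fibre: "x \<in> fibre r \<Longrightarrow> (F ^^ k) x \<in> fibre (\<lambda>n. r (n + k))"
  unfolding fibre_def using funpow_iterable representation_funpow by auto

lemma iterable_subset_unit: "B \<subseteq> {0..<1}"
proof
  fix x assume "x \<in> B"
  then have "R x 0 \<in> \<D>" "x \<in> \<Delta> (R x 0)"
    using representation_digit[of x 0] by auto
  then show "x \<in> {0..<1}"
    using pim unfolding piecewise_interval_map_def interval_partition_def by blast
qed

text \<open>A fibre is the intersection of the cylinders of the prefixes of \<open>r\<close>, and
  each of these is convex by condition (3) on PIMs. That \<open>z\<close> lies in \<open>B\<close>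
  is part of what follows.\<close>

lemma fibre_between:
  assumes "x \<in> fibre r" "y \<in> fibre r" "x \<le> z" "z \<le> y"
  shows "z \<in> fibre r"
proof (rule fibreI)
  show r: "range r \<subseteq> \<D>"
    using assms(1) representation_digit(1) unfolding fibre_def by blast
  fix n
  \<comment> \<open>With \<open>Suc n\<close> digits the prefix is nonempty, and its last digit
    constrains iterate \<open>n\<close>.\<close>
  let ?C = "cylinder \<Delta> F (map r [0..<Suc n])"
  have C: "w \<in> ?C \<longleftrightarrow> (\<forall>i<Suc n. (F ^^ i) w \<in> \<Delta> (r i))" for w
    unfolding cylinder_def by (auto simp del: upt_Suc)
  have "x \<in> ?C" "y \<in> ?C"
    using assms(1,2) representation_digit(2)[of x] representation_digit(2)[of y]
    unfolding C fibre_def by auto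
  moreover have "set (map r [0..<Suc n]) \<subseteq> \<D>" "map r [0..<Suc n] \<noteq> []"
    using r by auto
  then have "?C = {} \<or> proper_interval ?C"
    using pim unfolding piecewise_interval_map_def by blast
  ultimately have "convex ?C" using convex_proper_interval by auto
  then have "z \<in> ?C"
    using \<open>x \<in> ?C\<close> \<open>y \<in> ?C\<close> assms(3,4) by (meson is_interval_1 is_interval_convex_1)
  then show "(F ^^ n) z \<in> \<Delta> (r n)" unfolding C by blast
qed

section \<open>Monotonicity on fibres and eventually periodic representations\<close>

lemma monotone_step_fibre: "mono_on (fibre r) F \<or> antimono_on (fibre r) F"
proof (cases "fibre r = {}")
  case False
  then have "r 0 \<in> \<D>" using representation_digit(1) unfolding fibre_def by blast
  then have "strict_mono_on (\<Delta> (r 0)) F \<or> strict_antimono_on (\<Delta> (r 0)) F"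
    using pim unfolding piecewise_interval_map_def by blast
  then have "mono_on (\<Delta> (r 0)) F \<or> antimono_on (\<Delta> (r 0)) F"
    by (auto simp: monotone_on_def order_le_less)
  moreover have "fibre r \<subseteq> \<Delta> (r 0)"
    using representation_digit(2)[of _ 0] unfolding fibre_def by auto
  ultimately show ?thesis using monotone_on_subset by blast
qed (simp add: monotone_on_def)

text \<open>The iterate \<open>F ^^ n\<close> sends the fibre into that of the shifted sequence,
  where one more step of \<open>F\<close> has a single direction. Directions multiply under
  composition.\<close>

lemma monotone_funpow_fibre: "mono_on (fibre r) (F ^^ n) \<or> antimono_on (fibre r) (F ^^ n)"
proof (induction n)
  case (Suc n)
  define s where "s = (\<lambda>k. r (k + n))"
  have "(F ^^ n) ` fibre r \<subseteq> fibre s" using funpow_fibre s_def by blast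
  with Suc monotone_step_fibre[of s] show ?case
    by (simp add: monotone_on_def image_subset_iff) blast
qed (simp add: monotone_on_def)

text \<open>Periodicity makes \<open>F ^^ m\<close> a self-map of the fibre of \<open>q\<close>. It
  may reverse order there, but its square \<open>F ^^ (2 * m)\<close> preserves order; hence the
  factor 2.\<close>

lemma monoseq_funpow_of_period:
  assumes "q \<in> B" "R ((F ^^ m) q) = R q"
  shows "monoseq (\<lambda>k. (F ^^ (2 * m * k)) q)"
proof -
  let ?E = "fibre (R q)"
  have "(\<lambda>n. R q (n + m)) = R q"
    using assms(2) by (simp add: fun_eq_iff flip: representation_funpow)
  then have inv: "(F ^^ m) ` ?E \<subseteq> ?E" using funpow_fibre[of _ "R q" m] by auto
  have "F ^^ (2 * m) = F ^^ m \<circ> F ^^ m" by (simp add: mult_2 funpow_add)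
  then have "mono_on ?E (F ^^ (2 * m))" "(F ^^ (2 * m)) ` ?E \<subseteq> ?E"
    using monotone_funpow_fibre[of "R q" m] inv
    unfolding monotone_on_def image_subset_iff by (elim disjE; simp)+
  from monoseq_funpow_mono_on[OF this, of q] show ?thesis
    using assms(1) by (simp add: fibre_def funpow_mult mult.commute)
qed

lemma convergent_funpow_of_period:
  assumes "q \<in> B" "R ((F ^^ m) q) = R q"
  shows "convergent (\<lambda>k. (F ^^ (2 * m * k)) q)"
proof (rule Bseq_monoseq_convergent)
  have "(F ^^ k) q \<in> {0..<1}" for k
    using funpow_iterable[OF assms(1)] iterable_subset_unit by blast
  then show "Bseq (\<lambda>k. (F ^^ (2 * m * k)) q)"
    by (intro BseqI'[where K = 1]) (auto simp: less_imp_le)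
qed (rule monoseq_funpow_of_period[OF assms])

lemma countable_closure_orbit_of_period:
  assumes "x \<in> B" "m > 0" "R ((F ^^ (m + n)) x) = R ((F ^^ n) x)"
  shows "countable (closure (forward_orbit F x))"
proof (rule countable_closure_finite_Un_convergent)
  \<comment> \<open>The orbit points with index congruent to \<open>j + n\<close> modulo
    \<open>2 * m\<close>, from \<open>j + n\<close> on.\<close>
  let ?X = "\<lambda>j k. (F ^^ (2 * m * k)) ((F ^^ (j + n)) x)"
  show "finite ((\<lambda>i. (F ^^ i) x) ` {..<n})" "finite {..<2 * m}" by auto
  show "convergent (?X j)" for j
  proof (rule convergent_funpow_of_period)
    have "R x (i + (m + n)) = R x (i + n)" for i
      using assms(3) by (metis representation_funpow)
    \<comment> \<open>Every later point of the tail inherits the period \<open>m\<close>.\<close>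
    from this[of "_ + j"] show "R ((F ^^ m) ((F ^^ (j + n)) x)) = R ((F ^^ (j + n)) x)"
      by (intro ext) (simp add: representation_funpow ac_simps)
  qed (use assms(1) funpow_iterable in blast)
  have "(F ^^ i) x \<in> (\<Union>j\<in>{..<2 * m}. range (?X j))" if "i \<ge> n" for i
  proof -
    have "i = 2 * m * ((i - n) div (2 * m)) + ((i - n) mod (2 * m) + n)"
      using that by simp
    then have "(F ^^ i) x = ?X ((i - n) mod (2 * m)) ((i - n) div (2 * m))"
      by (metis funpow_add comp_apply)
    moreover have "(i - n) mod (2 * m) \<in> {..<2 * m}" using assms(2) by simp
    ultimately show ?thesis by blast
  qed
  then have "(F ^^ i) x \<in> (\<lambda>i. (F ^^ i) x) ` {..<n} \<union> (\<Union>j\<in>{..<2 * m}. range (?X j))" for i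
    by (cases "i < n") (blast, simp only: not_less Un_iff simp_thms)
  then show "forward_orbit F x \<subseteq>
      (\<lambda>i. (F ^^ i) x) ` {..<n} \<union> (\<Union>j\<in>{..<2 * m}. range (?X j))"
    unfolding forward_orbit_def by blast
qed

text \<open>The open interval between \<open>u\<close> and \<open>v\<close> lies in one fibre, so
  two visits of the orbit to it force periodicity and a countable closure, too small to contain
  [0,1).\<close>

lemma fibre_not_less_of_dense_orbit:
  assumes "x \<in> B" "{0..<1} \<subseteq> closure (forward_orbit F x)"
    and "u \<in> fibre r" "v \<in> fibre r"
  shows "\<not> u < v"
proof
  assume "u < v"
  have sub: "{u<..<v} \<subseteq> fibre r"
    using fibre_between[OF assms(3,4)] by auto
  then have "{u<..<v} \<subseteq> closure (range (\<lambda>n. (F ^^ n) x))"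
    using assms(2) iterable_subset_unit unfolding forward_orbit_def fibre_def by blast
  then have inf: "infinite {n. (F ^^ n) x \<in> {u<..<v}}"
    using \<open>u < v\<close> by (intro infinite_dense_seq_hits) auto
  obtain n where n: "(F ^^ n) x \<in> {u<..<v}"
    using inf not_finite_existsD by auto
  \<comment> \<open>A strictly later visit is needed so that the period \<open>n' - n\<close> is
    positive.\<close>
  obtain n' where n': "n' > n" "(F ^^ n') x \<in> {u<..<v}"
    using inf unfolding infinite_nat_iff_unbounded by blast
  have "R ((F ^^ (n' - n + n)) x) = R ((F ^^ n) x)"
    using n n' subsetD[OF sub] unfolding fibre_def by simp
  then have "countable (closure (forward_orbit F x))"
    using countable_closure_orbit_of_period[of x "n' - n" n] assms(1) n'(1) by simp
  then have "countable {0..<1::real}"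
    using assms(2) countable_subset by blast
  then show False
    using uncountable_half_open_interval_1[of 0 "1::real"] by simp
qed

end

theorem theorem11:
  fixes \<D> :: "'d set" and \<Delta> :: "'d \<Rightarrow> real set" and F :: "real \<Rightarrow> real"
  assumes "piecewise_interval_map \<D> \<Delta> F"
    and "topologically_transitive \<D> \<Delta> F"
  shows "valid_representations \<D> \<Delta> F"
proof -
  interpret piecewise_interval \<D> \<Delta> F
    by unfold_locales (fact assms(1))
  obtain x where x: "x \<in> B" "{0..<1} \<subseteq> closure (forward_orbit F x)"
    using assms(2) unfolding topologically_transitive_def by blast
  have "u = v" if "u \<in> B" "v \<in> B" "R u = R v" for u v
    using fibre_not_less_of_dense_orbit[OF x, of u "R u" v]
      fibre_not_less_of_dense_orbit[OF x, of v "R u" u] that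
    by (auto simp: fibre_def)
  \<comment> \<open>The exceptional null set is taken empty, as injectivity holds on all of
    \<open>B\<close>.\<close>
  then have "inj_on R (B - {})" by (auto intro: inj_onI)
  then show ?thesis
    unfolding valid_representations_def by (intro bexI[of _ "{}"]) auto
qed

end
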